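(* Algorithm for computing S-minimal curves. Input: $(a_1,\dots,a_6)\in\mathbb Z^6$ where all $a_i\ge 0$, the weight vector of a tetrahedral curve $C$. Output: $(a_1,\dots,a_6)$, the weight vector of an S-minimal curve obtained by reducing $C$. 1. Compute $i$ such that $a_i=\max\{a_1,\dots,a_6\}$. 2. If $a_i=0$ then return $(0,\dots,0)$. 3. Determine a facet $F$ of maximal weight $w$. 4. If $a_i+a_{7-i}>w$ then return $(a_1,\dots,a_6)$. 5. Apply the reduction corresponding to the facet $F$ and go to Step 1.
   Context: Let $k$ be a field and $R=k[a,b,c,d]$. For integers $a_1,\dots,a_6\ge0$, the tetrahedral curve with weight vector $(a_1,\dots,a_6)$ is the subscheme of $\mathbb P^3$ with saturated ideal $(a,b)^{a_1}\cap(a,c)^{a_2}\cap(a,d)^{a_3}\cap(b,c)^{a_4}\cap(b,d)^{a_5}\cap(c,d)^{a_6}$; $(0,\dots,0)$ is the trivial curve (ideal $R$). The number $a_i$ is the weight of the $i$-th line. The six lines are the edges of a tetrahedron whose four facets have edge index sets $\{1,2,3\},\{1,4,5\},\{2,4,6\},\{3,5,6\}$; the weight of a facet is the sum of the weights of its three edges. The lines with indices $i$ and $7-i$ do not intersect. Reductions. For a tetrahedral curve with not all $a_i$ zero consider the systems of inequalities (A): $a_1+a_2\ge a_4$, $a_1+a_3\ge a_5$, $a_2+a_3\ge a_6$; (B): $a_1+a_4\ge a_2$, $a_1+a_5\ge a_3$, $a_4+a_5\ge a_6$; (C): $a_2+a_4\ge a_1$, $a_2+a_6\ge a_3$, $a_4+a_6\ge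 a_5$; (D): $a_3+a_5\ge a_1$, $a_3+a_6\ge a_2$, $a_5+a_6\ge a_4$. The reduction corresponding to the facet $\{1,2,3\}$ (resp. $\{1,4,5\}$, $\{2,4,6\}$, $\{3,5,6\}$) is available when (A) (resp. (B), (C), (D)) holds; it replaces $a_i$ by $\max\{0,a_i-1\}$ for the indices $i$ of that facet and leaves the other weights unchanged (the original curve is then a basic double link of the new one). A tetrahedral curve is S-minimal if there is no such reduction of it; in particular the trivial curve is S-minimal. *)

theory Defs
  imports
    "HOL-Analysis.Finite_Cartesian_Product"
    "HOL-Library.Numeral_Type"
    "HOL-Library.Poly_Mapping"
begin

datatype var = Va | Vb | Vc | Vd

text \<open>\<open>R = k[a,b,c,d]\<close>: finitely supported functions from exponent vectors to coefficients,
  with the convolution product.\<close>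

type_synonym 'k quad_poly = "(var \<Rightarrow>\<^sub>0 nat) \<Rightarrow>\<^sub>0 'k"

definition X :: "var \<Rightarrow> 'k::field quad_poly" where
  "X v = Poly_Mapping.single (Poly_Mapping.single v 1) 1"

text \<open>An ideal is a submodule of the ring regarded as a module over itself.\<close>

definition ideal_gen :: "'a::comm_ring_1 set \<Rightarrow> 'a set" where
  "ideal_gen S = module.span (*) S"

primrec ideal_power :: "'a::comm_ring_1 set \<Rightarrow> nat \<Rightarrow> 'a set" where
  "ideal_power I 0 = UNIV"
| "ideal_power I (Suc n) = ideal_gen {x * y |x y. x \<in> I \<and> y \<in> ideal_power I n}"

definition line_ideal :: "var \<Rightarrow> var \<Rightarrow> 'k::field quad_poly set" where
  "line_ideal u v = ideal_gen {X u, X v}"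

text \<open>Weight vectors live in \<open>int ^ 6\<close>. The index type \<open>6\<close> is the integers modulo 6, so the index
  6 is the residue 0; the numerals \<open>1, \<dots>, 6\<close> are its six distinct elements and \<open>i \<mapsto> 7 - i\<close>
  acts on them as it does on the integers 1 to 6.\<close>

type_synonym weights = "int ^ 6"

definition nonneg_weights :: "weights \<Rightarrow> bool" where
  "nonneg_weights a \<longleftrightarrow> (\<forall>i. 0 \<le> a $ i)"

text \<open>A closed subscheme of projective 3-space is represented by its saturated homogeneous ideal.\<close>

definition tetrahedral_curve :: "weights \<Rightarrow> 'k::field quad_poly set" where
  "tetrahedral_curve a =
     ideal_power (line_ideal Va Vb) (nat (a $ 1)) \<inter>
     ideal_power (line_ideal Va Vc) (nat (a $ 2)) \<inter>
     ideal_power (line_ideal Va Vd) (nat (a $ 3)) \<inter>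
     ideal_power (line_ideal Vb Vc) (nat (a $ 4)) \<inter>
     ideal_power (line_ideal Vb Vd) (nat (a $ 5)) \<inter>
     ideal_power (line_ideal Vc Vd) (nat (a $ 6))"

definition is_weight_vector_of :: "weights \<Rightarrow> 'k::field quad_poly set \<Rightarrow> bool" where
  "is_weight_vector_of a C \<longleftrightarrow> nonneg_weights a \<and> C = tetrahedral_curve a"

definition facets :: "6 set set" where
  "facets = {{1,2,3}, {1,4,5}, {2,4,6}, {3,5,6}}"

definition facet_weight :: "weights \<Rightarrow> 6 set \<Rightarrow> int" where
  "facet_weight a F = (\<Sum>i\<in>F. a $ i)"

definition system_A :: "weights \<Rightarrow> bool" where
  "system_A a \<longleftrightarrow> a$1 + a$2 \<ge> a$4 \<and> a$1 + a$3 \<ge> a$5 \<and> a$2 + a$3 \<ge> a$6"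

definition system_B :: "weights \<Rightarrow> bool" where
  "system_B a \<longleftrightarrow> a$1 + a$4 \<ge> a$2 \<and> a$1 + a$5 \<ge> a$3 \<and> a$4 + a$5 \<ge> a$6"

definition system_C :: "weights \<Rightarrow> bool" where
  "system_C a \<longleftrightarrow> a$2 + a$4 \<ge> a$1 \<and> a$2 + a$6 \<ge> a$3 \<and> a$4 + a$6 \<ge> a$5"

definition system_D :: "weights \<Rightarrow> bool" where
  "system_D a \<longleftrightarrow> a$3 + a$5 \<ge> a$1 \<and> a$3 + a$6 \<ge> a$2 \<and> a$5 + a$6 \<ge> a$4"

definition reduction_available :: "weights \<Rightarrow> 6 set \<Rightarrow> bool" where
  "reduction_available a F \<longleftrightarrow> a \<noteq> 0 \<and>
     (F = {1,2,3} \<and> system_A a \<or> F = {1,4,5} \<and> system_B a \<or>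
      F = {2,4,6} \<and> system_C a \<or> F = {3,5,6} \<and> system_D a)"

definition reduce :: "6 set \<Rightarrow> weights \<Rightarrow> weights" where
  "reduce F a = (\<chi> i. if i \<in> F then max 0 (a $ i - 1) else a $ i)"

definition is_reduction_of :: "'k::field quad_poly set \<Rightarrow> 'k quad_poly set \<Rightarrow> bool" where
  "is_reduction_of D C \<longleftrightarrow> (\<exists>a F. is_weight_vector_of a C \<and> reduction_available a F \<and>
      D = tetrahedral_curve (reduce F a))"

definition S_minimal :: "'k::field quad_poly set \<Rightarrow> bool" where
  "S_minimal C \<longleftrightarrow> (\<exists>a. is_weight_vector_of a C) \<and> (\<nexists>D. is_reduction_of D C)"

definition obtained_by_reducing :: "'k::field quad_poly set \<Rightarrow> 'k quad_poly set \<Rightarrow> bool" where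
  "obtained_by_reducing D C \<longleftrightarrow> (\<lambda>C' D'. is_reduction_of D' C')\<^sup>*\<^sup>* C D"

text \<open>The algorithm leaves the choice of an index of maximal weight and of a facet of maximal
  weight open when there are ties, so it is modelled as a nondeterministic transition relation.
  One transition is one pass through Steps 1--5; \<open>Running a\<close> is the state at Step 1.\<close>

datatype state = Running weights | Returned weights

definition max_index :: "weights \<Rightarrow> 6 \<Rightarrow> bool" where
  "max_index a i \<longleftrightarrow> (\<forall>j. a $ j \<le> a $ i)"

definition max_facet :: "weights \<Rightarrow> 6 set \<Rightarrow> bool" where
  "max_facet a F \<longleftrightarrow> F \<in> facets \<and> (\<forall>G\<in>facets. facet_weight a G \<le> facet_weight a F)"

definition reaches_step_5 :: "weights \<Rightarrow> 6 \<Rightarrow> 6 set \<Rightarrow> bool" where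
  "reaches_step_5 a i F \<longleftrightarrow> max_index a i \<and> a $ i \<noteq> 0 \<and> max_facet a F \<and>
     \<not> a $ i + a $ (7 - i) > facet_weight a F"

text \<open>The third rule does not test whether the reduction is available: this is part of the
  correctness of the algorithm.\<close>

inductive alg_step :: "state \<Rightarrow> state \<Rightarrow> bool" where
  return_trivial: "max_index a i \<Longrightarrow> a $ i = 0 \<Longrightarrow> alg_step (Running a) (Returned 0)"
| return_current: "max_index a i \<Longrightarrow> a $ i \<noteq> 0 \<Longrightarrow> max_facet a F \<Longrightarrow>
    a $ i + a $ (7 - i) > facet_weight a F \<Longrightarrow> alg_step (Running a) (Returned a)"
| reduce_step: "reaches_step_5 a i F \<Longrightarrow> alg_step (Running a) (Running (reduce F a))"

end

theory Submission
  imports Defs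
begin

text \<open>Every component \<open>(u,v)\<^sup>n\<close> contains exactly the monomials of degree at least \<open>n\<close> in \<open>u, v\<close>;
  testing monomials that are very divisible by the other two variables recovers the weight of each
  line from the ideal. So S-minimality may be checked on the weight vector. For the combinatorics,
  each facet contains exactly one of two opposite edges \<open>i, 7 - i\<close>, and the other one is the
  right-hand side of an inequality of its system. That inequality fails for every facet if
  \<open>a\<^sub>i + a\<^bsub>7-i\<^esub>\<close> exceeds the maximal facet weight; otherwise maximality of
  \<open>a\<^sub>i\<close> and of the facet imply its system.\<close>

section \<open>The six edge indices\<close>

lemma UNIV_6: "(UNIV :: 6 set) = {1,2,3,4,5,6}"
proof -
  have "card {1,2,3,4,5,6::6} = card (UNIV :: 6 set)" by simp
  then show ?thesis by (intro card_subset_eq[symmetric]) auto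
qed

lemma exhaust_6: "(i::6) = 1 \<or> i = 2 \<or> i = 3 \<or> i = 4 \<or> i = 5 \<or> i = 6"
  using UNIV_I[of i] unfolding UNIV_6 by simp

lemma forall_6: "(\<forall>i::6. P i) \<longleftrightarrow> P 1 \<and> P 2 \<and> P 3 \<and> P 4 \<and> P 5 \<and> P 6"
  by (metis exhaust_6)

subsection \<open>Monomials in powers of line ideals\<close>

lemma module_times: "module ((*) :: 'a::comm_ring_1 \<Rightarrow> 'a \<Rightarrow> 'a)"
  by unfold_locales (auto simp: algebra_simps)

lemma ideal_gen_base: "x \<in> S \<Longrightarrow> x \<in> ideal_gen S"
  unfolding ideal_gen_def by (rule module.span_base[OF module_times])

lemma ideal_gen_subset:
  assumes "S \<subseteq> J" "0 \<in> J" "\<And>x y. x \<in> J \<Longrightarrow> y \<in> J \<Longrightarrow> x + y \<in> J"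
    "\<And>c x. x \<in> J \<Longrightarrow> c * x \<in> J"
  shows "ideal_gen S \<subseteq> J"
  unfolding ideal_gen_def
  by (rule module.span_minimal[OF module_times])
    (use assms in \<open>auto simp: module.subspace_def[OF module_times]\<close>)

text \<open>For \<open>u\<close> \<noteq> \<open>v\<close> this is the monomial description of the
  ideal power (u,v)^n. It makes membership of a single monomial a condition on two
  exponents.\<close>

definition monomial_order_ideal :: "var \<Rightarrow> var \<Rightarrow> nat \<Rightarrow> 'k::field quad_poly set" where
  "monomial_order_ideal u v n =
     {p. \<forall>m\<in>Poly_Mapping.keys p. n \<le> Poly_Mapping.lookup m u + Poly_Mapping.lookup m v}"

lemma mult_monomial_order_ideal:
  assumes "p \<in> monomial_order_ideal u v n" "q \<in> monomial_order_ideal u v n'"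
  shows "p * q \<in> monomial_order_ideal u v (n + n')"
  unfolding monomial_order_ideal_def
proof clarify
  fix m assume "m \<in> Poly_Mapping.keys (p * q)"
  then obtain s t where "m = s + t" "s \<in> Poly_Mapping.keys p" "t \<in> Poly_Mapping.keys q"
    using keys_mult[of p q] by blast
  with assms show "n + n' \<le> Poly_Mapping.lookup m u + Poly_Mapping.lookup m v"
    by (fastforce simp: monomial_order_ideal_def lookup_add)
qed

lemma ideal_gen_subset_monomial_order_ideal:
  assumes "S \<subseteq> monomial_order_ideal u v n"
  shows "ideal_gen S \<subseteq> monomial_order_ideal u v n"
proof (rule ideal_gen_subset[OF assms])
  show "0 \<in> monomial_order_ideal u v n" by (simp add: monomial_order_ideal_def)
next
  fix x y :: "'a quad_poly"
  assume "x \<in> monomial_order_ideal u v n" "y \<in> monomial_order_ideal u v n"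
  then show "x + y \<in> monomial_order_ideal u v n"
    using Poly_Mapping.keys_add[of x y] by (auto simp: monomial_order_ideal_def)
next
  fix c x :: "'a quad_poly"
  assume "x \<in> monomial_order_ideal u v n"
  \<comment> \<open>Every polynomial has order at least 0, so closure under arbitrary multiples is
    the product rule with exponents 0 and \<open>n\<close>.\<close>
  moreover have "c \<in> monomial_order_ideal u v 0" by (simp add: monomial_order_ideal_def)
  ultimately show "c * x \<in> monomial_order_ideal u v n"
    using mult_monomial_order_ideal[of c u v 0 x n] by simp
qed

lemma line_ideal_subset: "line_ideal u v \<subseteq> monomial_order_ideal u v 1"
  unfolding line_ideal_def
  by (rule ideal_gen_subset_monomial_order_ideal)
    (auto simp: X_def monomial_order_ideal_def lookup_single when_def)

lemma ideal_power_line_ideal_subset: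
  "ideal_power (line_ideal u v) n \<subseteq> monomial_order_ideal u v n"
proof (induction n)
  case 0
  show ?case by (auto simp: monomial_order_ideal_def)
next
  case (Suc n)
  have "x * y \<in> monomial_order_ideal u v (Suc n)"
    if "x \<in> line_ideal u v" "y \<in> ideal_power (line_ideal u v) n" for x y :: "'a quad_poly"
    using mult_monomial_order_ideal[of x u v 1 y n] that line_ideal_subset Suc by auto
  then show ?case
    by (auto intro!: ideal_gen_subset_monomial_order_ideal simp del: One_nat_def)
qed

text \<open>One variable of the line is split off per factor of the power.\<close>

lemma monomial_mem_ideal_power:
  assumes "u \<noteq> v" "n \<le> Poly_Mapping.lookup m u + Poly_Mapping.lookup m v"
  shows "(Poly_Mapping.single m 1 :: 'k::field quad_poly) \<in> ideal_power (line_ideal u v) n"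
  using assms(2)
proof (induction n arbitrary: m)
  case 0
  show ?case by simp
next
  case (Suc n)
  obtain w where w: "w = u \<or> w = v" "Poly_Mapping.lookup m w > 0"
    using Suc.prems by (metis add_is_0 gr0I not_less_eq_eq zero_le)
  define m' where "m' = m - Poly_Mapping.single w 1"
  \<comment> \<open>The exponent of \<open>w\<close> is positive, so the truncated subtraction in
    \<open>m'\<close> is exact.\<close>
  have m: "m = Poly_Mapping.single w 1 + m'"
    using w(2) by (intro poly_mapping_eqI)
      (auto simp: m'_def lookup_add lookup_minus lookup_single when_def)
  \<comment> \<open>As \<open>u\<close> \<noteq> \<open>v\<close>, removing one \<open>w\<close>
    lowers the combined degree by exactly one.\<close>
  have "n \<le> Poly_Mapping.lookup m' u + Poly_Mapping.lookup m' v"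
    using Suc.prems w(1) assms(1) by (auto simp: m lookup_add lookup_single when_def)
  then have "(Poly_Mapping.single m' 1 :: 'k quad_poly) \<in> ideal_power (line_ideal u v) n"
    using Suc.IH by blast
  moreover have "X w \<in> line_ideal u v"
    unfolding line_ideal_def using w(1) by (intro ideal_gen_base) auto
  moreover have "Poly_Mapping.single m 1 = X w * (Poly_Mapping.single m' 1 :: 'k quad_poly)"
    by (simp add: m X_def mult_single)
  ultimately show ?case
    by (auto intro!: ideal_gen_base)
qed

lemma monomial_mem_ideal_power_iff:
  assumes "u \<noteq> v"
  shows "(Poly_Mapping.single m 1 :: 'k::field quad_poly) \<in> ideal_power (line_ideal u v) n \<longleftrightarrow>
    n \<le> Poly_Mapping.lookup m u + Poly_Mapping.lookup m v"
  using monomial_mem_ideal_power[OF assms, of n m, where 'k = 'k]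
    ideal_power_line_ideal_subset[of u v n, where 'a = 'k]
  by (auto simp: monomial_order_ideal_def)

section \<open>Recovering the weight vector from the ideal\<close>

lemma tetrahedral_curve_subset_imp_le:
  fixes a b :: weights
  assumes nonneg: "nonneg_weights a"
    and sub: "(tetrahedral_curve a :: 'k::field quad_poly set) \<subseteq> tetrahedral_curve b"
  shows "b $ i \<le> a $ i"
proof -
  \<comment> \<open>\<open>N\<close> bounds every weight of \<open>a\<close>. An exponent
    \<open>N\<close> on both variables off a line therefore satisfies the conditions of the other
    five lines, each of which involves one of these variables.\<close>
  define N where "N = nat (a$1 + a$2 + a$3 + a$4 + a$5 + a$6)"
  define mono where "mono p q r s = Poly_Mapping.single Va p + Poly_Mapping.single Vb q +
    Poly_Mapping.single Vc r + Poly_Mapping.single Vd s" for p q r s :: nat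
  have mem: "(Poly_Mapping.single (mono p q r s) 1 :: 'k quad_poly) \<in> tetrahedral_curve c \<longleftrightarrow>
      c$1 \<le> p + q \<and> c$2 \<le> p + r \<and> c$3 \<le> p + s \<and> c$4 \<le> q + r \<and> c$5 \<le> q + s \<and> c$6 \<le> r + s"
    for p q r s :: nat and c :: weights
    by (auto simp: tetrahedral_curve_def monomial_mem_ideal_power_iff mono_def lookup_add
        lookup_single nat_le_iff)
  note sub_mono = subsetD[OF sub, of "Poly_Mapping.single (mono p q r s) 1" for p q r s,
      unfolded mem]
  have a: "0 \<le> a$1" "0 \<le> a$2" "0 \<le> a$3" "0 \<le> a$4" "0 \<le> a$5" "0 \<le> a$6"
    using nonneg by (auto simp: nonneg_weights_def)
  then have N: "int N = a$1 + a$2 + a$3 + a$4 + a$5 + a$6" by (simp add: N_def)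
  \<comment> \<open>On the tested line the two exponents are its weight in \<open>a\<close> and 0.
    The monomial lies in the ideal of \<open>a\<close>, hence in that of \<open>b\<close>, which
    bounds the weight in \<open>b\<close>.\<close>
  have "b$1 \<le> a$1" using sub_mono[of "nat (a$1)" 0 N N] a N by simp
  moreover have "b$2 \<le> a$2" using sub_mono[of "nat (a$2)" N 0 N] a N by simp
  moreover have "b$3 \<le> a$3" using sub_mono[of "nat (a$3)" N N 0] a N by simp
  moreover have "b$4 \<le> a$4" using sub_mono[of N "nat (a$4)" 0 N] a N by simp
  moreover have "b$5 \<le> a$5" using sub_mono[of N "nat (a$5)" N 0] a N by simp
  moreover have "b$6 \<le> a$6" using sub_mono[of N N "nat (a$6)" 0] a N by simp
  ultimately show ?thesis using exhaust_6[of i] by auto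
qed

lemma tetrahedral_curve_inject:
  fixes C :: "'k::field quad_poly set"
  assumes "is_weight_vector_of a C" "is_weight_vector_of b C"
  shows "a = b"
  using assms
    tetrahedral_curve_subset_imp_le[of a b, where 'k = 'k]
    tetrahedral_curve_subset_imp_le[of b a, where 'k = 'k]
  by (auto simp: is_weight_vector_of_def vec_eq_iff intro!: antisym)

text \<open>A reduction of a curve may start from any weight vector representing it; by injectivity
  \<open>a\<close> is the only one.\<close>

lemma S_minimal_iff:
  fixes C :: "'k::field quad_poly set"
  assumes "is_weight_vector_of a C"
  shows "S_minimal C \<longleftrightarrow> (\<nexists>F. reduction_available a F)"
  using assms tetrahedral_curve_inject[OF assms]
  unfolding S_minimal_def is_reduction_of_def by blast

subsection \<open>Combinatorics of the reductions\<close>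

lemma nonneg_weights_iff:
  "nonneg_weights a \<longleftrightarrow> 0 \<le> a$1 \<and> 0 \<le> a$2 \<and> 0 \<le> a$3 \<and> 0 \<le> a$4 \<and> 0 \<le> a$5 \<and> 0 \<le> a$6"
  unfolding nonneg_weights_def by (rule forall_6)

lemma nonneg_weights_reduce: "nonneg_weights a \<Longrightarrow> nonneg_weights (reduce F a)"
  by (simp add: nonneg_weights_def reduce_def)

lemma facet_weight_simps:
  "facet_weight a {1,2,3} = a$1 + a$2 + a$3"
  "facet_weight a {1,4,5} = a$1 + a$4 + a$5"
  "facet_weight a {2,4,6} = a$2 + a$4 + a$6"
  "facet_weight a {3,5,6} = a$3 + a$5 + a$6"
  by (simp_all add: facet_weight_def)

lemma max_facet_iff:
  "max_facet a F \<longleftrightarrow> F \<in> facets \<and> a$1 + a$2 + a$3 \<le> facet_weight a F \<and>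
     a$1 + a$4 + a$5 \<le> facet_weight a F \<and> a$2 + a$4 + a$6 \<le> facet_weight a F \<and>
     a$3 + a$5 + a$6 \<le> facet_weight a F"
  by (auto simp: max_facet_def facets_def facet_weight_simps)

text \<open>Adding the third edge of \<open>F\<close> to each inequality of its system turns the
  system into: every opposite pair has sum at most the weight of \<open>F\<close>. For the pair of
  \<open>i\<close> this is the negated test of Step 4. For another pair j, 7-j, the facet containing
  \<open>i\<close> and j has weight at least \<open>a $ i\<close> plus the weight of j, hence at
  least the sum of the pair, because \<open>a $ i\<close> is maximal and weights are nonnegative.
  Maximality of \<open>F\<close> finishes the argument.\<close>

lemma reduction_available_of_max:
  assumes "nonneg_weights a" "reaches_step_5 a i F"
  shows "reduction_available a F"
proof -
  have "a \<noteq> 0" using assms(2) by (auto simp: reaches_step_5_def)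
  have nn: "0 \<le> a$1" "0 \<le> a$2" "0 \<le> a$3" "0 \<le> a$4" "0 \<le> a$5" "0 \<le> a$6"
    using assms(1) by (auto simp: nonneg_weights_def)
  have mi: "a$1 \<le> a$i" "a$2 \<le> a$i" "a$3 \<le> a$i" "a$4 \<le> a$i" "a$5 \<le> a$i" "a$6 \<le> a$i"
    and le: "a $ i + a $ (7 - i) \<le> facet_weight a F"
    and mf: "max_facet a F"
    using assms(2) by (auto simp: reaches_step_5_def max_index_def)
  consider "F = {1,2,3}" | "F = {1,4,5}" | "F = {2,4,6}" | "F = {3,5,6}"
    using mf by (auto simp: max_facet_def facets_def)
  then show ?thesis
  proof cases
    case 1
    have "system_A a"
      using exhaust_6[of i] nn mi le mf unfolding 1 max_facet_iff facet_weight_simps system_A_def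
      by auto
    with 1 \<open>a \<noteq> 0\<close> show ?thesis by (simp add: reduction_available_def)
  next
    case 2
    have "system_B a"
      using exhaust_6[of i] nn mi le mf unfolding 2 max_facet_iff facet_weight_simps system_B_def
      by auto
    with 2 \<open>a \<noteq> 0\<close> show ?thesis by (simp add: reduction_available_def)
  next
    case 3
    have "system_C a"
      using exhaust_6[of i] nn mi le mf unfolding 3 max_facet_iff facet_weight_simps system_C_def
      by auto
    with 3 \<open>a \<noteq> 0\<close> show ?thesis by (simp add: reduction_available_def)
  next
    case 4
    have "system_D a"
      using exhaust_6[of i] nn mi le mf unfolding 4 max_facet_iff facet_weight_simps system_D_def
      by auto
    with 4 \<open>a \<noteq> 0\<close> show ?thesis by (simp add: reduction_available_def)
  qed
qed

text \<open>In the system of any facet \<open>G\<close>, the inequality for the pair of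
  \<open>i\<close> says that the pair has sum at most the weight of \<open>G\<close>, which is at
  most that of \<open>F\<close>.\<close>

lemma no_reduction_of_opposite_sum:
  assumes "max_facet a F" "facet_weight a F < a $ i + a $ (7 - i)"
  shows "\<not> reduction_available a G"
  using exhaust_6[of i] assms
  by (auto simp: reduction_available_def max_facet_iff
      system_A_def system_B_def system_C_def system_D_def)

section \<open>Termination measure and existence of maximal choices\<close>

definition total_weight :: "weights \<Rightarrow> nat" where
  "total_weight a = nat (\<Sum>i\<in>UNIV. a $ i)"

lemma total_weight_reduce:
  assumes "nonneg_weights a" "reaches_step_5 a i F"
  shows "total_weight (reduce F a) < total_weight a"
proof -
  have F: "F \<in> facets" and "a $ i \<noteq> 0" using assms(2)
    by (auto simp: reaches_step_5_def max_facet_def)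
  \<comment> \<open>The weight \<open>a $ i\<close> is nonzero, hence positive, and is at most the
    weight of \<open>F\<close>. Some edge of \<open>F\<close> is then positive and drops by one,
    while no weight increases.\<close>
  have "facet_weight a F > 0"
    using exhaust_6[of i] assms \<open>a $ i \<noteq> 0\<close>
    by (auto simp: reaches_step_5_def max_facet_iff nonneg_weights_iff)
  then obtain j where j: "j \<in> F" "a $ j > 0"
    unfolding facet_weight_def by (meson not_less sum_nonpos)
  have nn: "0 \<le> a $ k" for k using assms(1) by (simp add: nonneg_weights_def)
  have "(\<Sum>k\<in>UNIV. reduce F a $ k) < (\<Sum>k\<in>UNIV. a $ k)"
    by (rule sum_strict_mono_ex1) (use nn j in \<open>auto simp: reduce_def intro!: bexI[of _ j]\<close>)
  moreover have "0 \<le> (\<Sum>k\<in>UNIV. reduce F a $ k)"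
    using nonneg_weights_reduce[OF assms(1)] by (simp add: sum_nonneg nonneg_weights_def)
  ultimately show ?thesis by (simp add: total_weight_def)
qed

lemma ex_max_index: "\<exists>i. max_index a i"
proof -
  have "Max (range (\<lambda>j. a $ j)) \<in> range (\<lambda>j. a $ j)" by (rule Max_in) auto
  then obtain i where "Max (range (\<lambda>j. a $ j)) = a $ i" by (rule rangeE)
  moreover have "a $ j \<le> Max (range (\<lambda>j. a $ j))" for j by (rule Max_ge) auto
  ultimately show ?thesis unfolding max_index_def by metis
qed

lemma ex_max_facet: "\<exists>F. max_facet a F"
proof -
  have "Max (facet_weight a ` facets) \<in> facet_weight a ` facets"
    by (rule Max_in) (auto simp: facets_def)
  then obtain F where "F \<in> facets" "Max (facet_weight a ` facets) = facet_weight a F" by auto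
  moreover have "facet_weight a G \<le> Max (facet_weight a ` facets)" if "G \<in> facets" for G
    using that by (intro Max_ge) (auto simp: facets_def)
  ultimately show ?thesis unfolding max_facet_def by metis
qed

subsection \<open>Runs of the algorithm\<close>

text \<open>Once a maximal index and a maximal facet are chosen, the guards of the three rules cover
  all cases.\<close>

lemma Running_not_final: "\<exists>s. alg_step (Running a) s"
proof -
  obtain i F where iF: "max_index a i" "max_facet a F"
    using ex_max_index ex_max_facet by blast
  then show ?thesis
    using return_trivial[OF iF(1)] return_current[OF iF(1) _ iF(2)] reduce_step[of a i F]
    unfolding reaches_step_5_def by blast
qed

text \<open>The invariant of a run started at \<open>C\<close>; returning adds the obligation of
  S-minimality.\<close>

fun state_correct :: "'k::field quad_poly set \<Rightarrow> state \<Rightarrow> bool" where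
  "state_correct C (Running a) \<longleftrightarrow>
     nonneg_weights a \<and> obtained_by_reducing (tetrahedral_curve a) C"
| "state_correct C (Returned a) \<longleftrightarrow>
     nonneg_weights a \<and> obtained_by_reducing (tetrahedral_curve a) C \<and>
     S_minimal (tetrahedral_curve a :: 'k quad_poly set)"

lemma alg_step_state_correct:
  fixes C :: "'k::field quad_poly set"
  assumes "alg_step s s'" "state_correct C s"
  shows "state_correct C s'"
  using assms
proof cases
  case (return_trivial a i)
  \<comment> \<open>A zero maximum forces all nonnegative weights to vanish, and availability of a
    reduction excludes the zero vector.\<close>
  with assms(2) have "a = 0"
    by (auto simp: max_index_def nonneg_weights_def vec_eq_iff intro: antisym)
  moreover have "is_weight_vector_of 0 (tetrahedral_curve 0 :: 'k quad_poly set)"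
    by (simp add: is_weight_vector_of_def nonneg_weights_def)
  ultimately show ?thesis
    using return_trivial assms(2) S_minimal_iff[of 0 "tetrahedral_curve 0 :: 'k quad_poly set"]
    by (simp add: reduction_available_def)
next
  case (return_current a i F)
  with assms(2) show ?thesis
    using S_minimal_iff[of a "tetrahedral_curve a :: 'k quad_poly set"]
      no_reduction_of_opposite_sum[of a F i]
    by (simp add: is_weight_vector_of_def)
next
  case (reduce_step a i F)
  with assms(2) have "reduction_available a F" by (simp add: reduction_available_of_max)
  then have "is_reduction_of (tetrahedral_curve (reduce F a) :: 'k quad_poly set)
      (tetrahedral_curve a)"
    using reduce_step assms(2) by (auto simp: is_reduction_of_def is_weight_vector_of_def)
  then show ?thesis
    using reduce_step assms(2)
    by (auto simp: nonneg_weights_reduce obtained_by_reducing_def intro: rtranclp.rtrancl_into_rtrancl)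
qed

lemma reachable_state_correct:
  fixes C :: "'k::field quad_poly set"
  assumes "is_weight_vector_of a C" "alg_step\<^sup>*\<^sup>* (Running a) s"
  shows "state_correct C s"
  using assms(2)
proof (induction rule: rtranclp_induct)
  case base
  show ?case using assms(1) by (simp add: is_weight_vector_of_def obtained_by_reducing_def)
next
  case (step s s')
  then show ?case using alg_step_state_correct by blast
qed

text \<open>Each reduction lowers the total weight by at least one, so after \<open>n\<close> steps
  total weight plus \<open>n\<close> is still bounded by the initial total.\<close>

lemma alg_terminates:
  assumes "nonneg_weights a"
  shows "\<nexists>s. s 0 = Running a \<and> (\<forall>n. alg_step (s n) (s (Suc n)))"
proof
  assume "\<exists>s. s 0 = Running a \<and> (\<forall>n. alg_step (s n) (s (Suc n)))"
  then obtain s where s: "s 0 = Running a" "\<And>n. alg_step (s n) (s (Suc n))" by blast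
  have "\<exists>b. s n = Running b \<and> nonneg_weights b \<and> total_weight b + n \<le> total_weight a" for n
  proof (induction n)
    case 0
    show ?case using s(1) assms by simp
  next
    case (Suc n)
    then obtain b where b: "s n = Running b" "nonneg_weights b"
      "total_weight b + n \<le> total_weight a" by blast
    \<comment> \<open>A returned state has no successor, so an infinite run never visits
      one.\<close>
    have not_final: "\<And>c. s (Suc n) \<noteq> Returned c" using s(2)[of "Suc n"] by (auto elim: alg_step.cases)
    obtain i F where "s (Suc n) = Running (reduce F b)" "reaches_step_5 b i F"
      using s(2)[of n] unfolding b(1) by cases (auto simp: not_final)
    then show ?case
      using b total_weight_reduce[of b i F] nonneg_weights_reduce by fastforce
  qed
  \<comment> \<open>One step more than the initial total weight violates the bound.\<close>
  from this[of "Suc (total_weight a)"] show False by auto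
qed

theorem mainTheorem4:
  fixes a :: weights and C :: "'k::field quad_poly set"
  assumes "is_weight_vector_of a C"
  shows
    \<comment> \<open>every run terminates\<close>
    "(\<nexists>s. s 0 = Running a \<and> (\<forall>n. alg_step (s n) (s (Suc n)))) \<and>
    \<comment> \<open>a run can only end by returning a weight vector\<close>
     (\<forall>s. alg_step\<^sup>*\<^sup>* (Running a) s \<longrightarrow> (\<nexists>s'. alg_step s s') \<longrightarrow> (\<exists>b. s = Returned b)) \<and>
    \<comment> \<open>whenever Step 5 is reached, the reduction to be applied is available\<close>
     (\<forall>a' i F. alg_step\<^sup>*\<^sup>* (Running a) (Running a') \<longrightarrow> reaches_step_5 a' i F \<longrightarrow>
        reduction_available a' F) \<and>
    \<comment> \<open>the output is correct\<close>
     (\<forall>b. alg_step\<^sup>*\<^sup>* (Running a) (Returned b) \<longrightarrow>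
        (\<exists>D :: 'k quad_poly set. is_weight_vector_of b D \<and> S_minimal D \<and> obtained_by_reducing D C))"
proof (intro conjI allI impI)
  have "nonneg_weights a" using assms by (simp add: is_weight_vector_of_def)
  then show "\<nexists>s. s 0 = Running a \<and> (\<forall>n. alg_step (s n) (s (Suc n)))" by (rule alg_terminates)
next
  \<comment> \<open>A running state always has a successor, so a state without one is
    returned.\<close>
  fix s assume "\<nexists>s'. alg_step s s'"
  then show "\<exists>b. s = Returned b" using Running_not_final by (cases s) auto
next
  fix a' i F
  assume "alg_step\<^sup>*\<^sup>* (Running a) (Running a')" "reaches_step_5 a' i F"
  then show "reduction_available a' F"
    using reachable_state_correct[OF assms] reduction_available_of_max by fastforce
next
  fix b assume "alg_step\<^sup>*\<^sup>* (Running a) (Returned b)"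
  then have "state_correct C (Returned b)" by (rule reachable_state_correct[OF assms])
  then show "\<exists>D :: 'k quad_poly set.
      is_weight_vector_of b D \<and> S_minimal D \<and> obtained_by_reducing D C"
    \<comment> \<open>The witness is \<open>tetrahedral_curve b\<close>; the invariant supplies its
      properties.\<close>
    by (auto simp: is_weight_vector_of_def)
qed

end
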